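(* Let $G$ be a second countable, locally Hausdorff, locally compact continuous groupoid on $X$. Then $X$ contains a complete lacunary section; that is, there is a Borel set $Y \subseteq X$ such that $Y$ contains a point of every orbit of $G$ in $X$, and there is a set $U$, open in $G$ and containing $X$, such that $([y]U) \cap Y = \{y\}$ for every $y \in Y$.
   Context: A groupoid $G$ on a set $X$ is a small category with inverses having object (unit) set $X$, with range and source maps $r,s : G \to X$; the product $\gamma\gamma'$ is defined exactly on $G^{(2)} = \{(\gamma,\gamma') \in G\times G : s(\gamma)=r(\gamma')\}$, with $r(\gamma\gamma') = r(\gamma)$ and $s(\gamma\gamma') = s(\gamma')$. Each $x\in X$ is identified with the identity $i_x \in G$, so $X \subseteq G$. Topological assumptions: $X$ is second countable, locally compact and Hausdorff; $G$ is second countable, locally compact and locally Hausdorff (every point has a Hausdorff neighborhood); $\{i_x : x\in X\}$ is closed in $G$ and homeomorphic to $X$ via $x \mapsto i_x$. $G$ is called continuous if all the structure maps ($r$, $s$, multiplication on $G^{(2)}$ with the relative product topology, inversion) are continuous. The map $r$ is not assumed to be open. For $A,B\subseteq G$, $AB = \{\gamma\gamma' : \gamma\in A,\ \gamma'\in B,\ s(\gamma)=r(\gamma')\}$. For $A\subseteq X$ and $B \subseteq G$, $[A]B = s(AB) \subseteq X$, where $A$ is regarded as a subset of $G$; thus for $y \in X$, $[y]B = \{s(\gamma) : \gamma\in B,\ r(\gamma)=y\}$. The orbit of $x\in X$ is $[x] = s(xG) = \{s(\gamma) : \gamma \in G,\ r(\gamma)=x\}$. *)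

theory Defs
  imports "HOL-Analysis.Analysis"
begin

text \<open>
  The identification of a unit \<open>x\<close> with its identity arrow is made explicit by the map
  \<open>gid\<close>: a subset \<open>A\<close> of the unit space, regarded as a set of arrows, is \<open>gid G ` A\<close>.
  The value \<open>gmult G g h\<close> is meaningful only if \<open>gsrc G g = grng G h\<close>.
\<close>

record ('g, 'x) top_groupoid =
  arr_top :: "'g topology"
  unit_top :: "'x topology"
  grng :: "'g \<Rightarrow> 'x"
  gsrc :: "'g \<Rightarrow> 'x"
  gid :: "'x \<Rightarrow> 'g"
  gmult :: "'g \<Rightarrow> 'g \<Rightarrow> 'g"
  ginv :: "'g \<Rightarrow> 'g"

definition arrows :: "('g, 'x, 'm) top_groupoid_scheme \<Rightarrow> 'g set" where
  "arrows G = topspace (arr_top G)"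

definition units :: "('g, 'x, 'm) top_groupoid_scheme \<Rightarrow> 'x set" where
  "units G = topspace (unit_top G)"

definition composable :: "('g, 'x, 'm) top_groupoid_scheme \<Rightarrow> ('g \<times> 'g) set" where
  "composable G = {(g, h). g \<in> arrows G \<and> h \<in> arrows G \<and> gsrc G g = grng G h}"

locale groupoid =
  fixes G :: "('g, 'x, 'm) top_groupoid_scheme" (structure)
  assumes rng_closed: "g \<in> arrows G \<Longrightarrow> grng G g \<in> units G"
    and src_closed: "g \<in> arrows G \<Longrightarrow> gsrc G g \<in> units G"
    and id_closed: "x \<in> units G \<Longrightarrow> gid G x \<in> arrows G"
    and rng_id: "x \<in> units G \<Longrightarrow> grng G (gid G x) = x"
    and src_id: "x \<in> units G \<Longrightarrow> gsrc G (gid G x) = x"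
    and mult_closed: "(g, h) \<in> composable G \<Longrightarrow> gmult G g h \<in> arrows G"
    and rng_mult: "(g, h) \<in> composable G \<Longrightarrow> grng G (gmult G g h) = grng G g"
    and src_mult: "(g, h) \<in> composable G \<Longrightarrow> gsrc G (gmult G g h) = gsrc G h"
    and mult_assoc: "(g, h) \<in> composable G \<Longrightarrow> (h, k) \<in> composable G \<Longrightarrow>
          gmult G (gmult G g h) k = gmult G g (gmult G h k)"
    and id_left: "g \<in> arrows G \<Longrightarrow> gmult G (gid G (grng G g)) g = g"
    and id_right: "g \<in> arrows G \<Longrightarrow> gmult G g (gid G (gsrc G g)) = g"
    and inv_closed: "g \<in> arrows G \<Longrightarrow> ginv G g \<in> arrows G"
    and rng_inv: "g \<in> arrows G \<Longrightarrow> grng G (ginv G g) = gsrc G g"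
    and src_inv: "g \<in> arrows G \<Longrightarrow> gsrc G (ginv G g) = grng G g"
    and inv_right: "g \<in> arrows G \<Longrightarrow> gmult G g (ginv G g) = gid G (grng G g)"
    and inv_left: "g \<in> arrows G \<Longrightarrow> gmult G (ginv G g) g = gid G (gsrc G g)"

text \<open>Openness of the range map is deliberately not required.\<close>

locale continuous_groupoid = groupoid +
  assumes continuous_rng: "continuous_map (arr_top G) (unit_top G) (grng G)"
    and continuous_src: "continuous_map (arr_top G) (unit_top G) (gsrc G)"
    and continuous_mult:
      "continuous_map (subtopology (prod_topology (arr_top G) (arr_top G)) (composable G))
         (arr_top G) (\<lambda>(g, h). gmult G g h)"
    and continuous_inv: "continuous_map (arr_top G) (arr_top G) (ginv G)"

definition locally_Hausdorff_space :: "'a topology \<Rightarrow> bool" where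
  "locally_Hausdorff_space T \<longleftrightarrow>
     (\<forall>x \<in> topspace T. \<exists>U N. openin T U \<and> x \<in> U \<and> U \<subseteq> N \<and> N \<subseteq> topspace T \<and>
        Hausdorff_space (subtopology T N))"

definition borel_sets_of :: "'a topology \<Rightarrow> 'a set set" where
  "borel_sets_of T = sigma_sets (topspace T) {U. openin T U}"

definition arrow_prod ::
    "('g, 'x, 'm) top_groupoid_scheme \<Rightarrow> 'g set \<Rightarrow> 'g set \<Rightarrow> 'g set" where
  "arrow_prod G A B = {gmult G g h | g h. g \<in> A \<and> h \<in> B \<and> gsrc G g = grng G h}"

text \<open>The set \<open>[A]B\<close>.\<close>

definition translate ::
    "('g, 'x, 'm) top_groupoid_scheme \<Rightarrow> 'x set \<Rightarrow> 'g set \<Rightarrow> 'x set" where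
  "translate G A B = gsrc G ` arrow_prod G (gid G ` A) B"

definition orbit :: "('g, 'x, 'm) top_groupoid_scheme \<Rightarrow> 'x \<Rightarrow> 'x set" where
  "orbit G x = translate G {x} (arrows G)"

lemma (in groupoid) translate_singleton:
  assumes "y \<in> units G" and "B \<subseteq> arrows G"
  shows "translate G {y} B = {gsrc G g | g. g \<in> B \<and> grng G g = y}"
proof -
  have "arrow_prod G (gid G ` {y}) B = {g \<in> B. grng G g = y}"
    using assms src_id[of y] id_left by (force simp: arrow_prod_def)
  then show ?thesis
    by (auto simp: translate_def)
qed

lemma (in groupoid) orbit_eq:
  assumes "x \<in> units G"
  shows "orbit G x = {gsrc G g | g. g \<in> arrows G \<and> grng G g = x}"
  using translate_singleton[OF assms subset_refl] by (simp add: orbit_def)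

end

theory Submission
  imports Defs
begin

text \<open>
  Since the unit space is closed, \<open>G\<close> is Hausdorff. There is an open \<open>U \<supseteq> X\<close> such that every compact
  \<open>C \<subseteq> X\<close> of a fixed countable cover admits a compact set of arrows containing \<open>U \<inter> r\<^sup>-\<^sup>1(C)\<close>.
  Call \<open>x\<close> and \<open>y\<close> near if \<open>y \<in> [x]U\<close>. The obstruction to nearness being transitive is isotropy that
  is large compared with \<open>U\<close>; recording which pieces of a finite cover of a compact set of arrows
  are met by the isotropy group at \<open>x\<close>, one obtains countably many compact sets \<open>A\<^sub>n\<close> covering \<open>X\<close> on
  each of which nearness is a closed equivalence relation. Such a relation has a Borel transversal
  \<open>T\<^sub>n\<close>. As the saturation \<open>[A\<^sub>n]\<close> of a compact set is a countable union of compact sets, it is Borel,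
  so no projection theorem is needed, and
  \<open>Y = \<Union>n. T\<^sub>n - (\<Union>m<n. [A\<^sub>m])\<close> is the desired section: points of \<open>Y\<close> in one orbit lie in the same \<open>T\<^sub>n\<close>.
\<close>

section \<open>Borel sets, compact neighbourhood bases and Borel transversals\<close>

lemma sigma_algebra_borel_sets_of: "sigma_algebra (topspace X) (borel_sets_of X)"
  unfolding borel_sets_of_def by (rule sigma_algebra_sigma_sets) (auto dest: openin_subset)

lemma closedin_borel_sets_of:
  assumes "closedin X C"
  shows "C \<in> borel_sets_of X"
proof -
  have "topspace X - C \<in> borel_sets_of X"
    using assms unfolding borel_sets_of_def by (auto intro: sigma_sets.Basic)
  then have "topspace X - (topspace X - C) \<in> borel_sets_of X"
    unfolding borel_sets_of_def by (rule sigma_sets.Compl)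
  then show ?thesis
    using closedin_subset[OF assms] by (simp add: double_diff)
qed

text \<open>Keep the closures of those members of a countable base that have compact closure. A base
  member inside a closed compact \<open>K \<subseteq> U\<close> has its closure inside
  \<open>K\<close>, so enough of them survive.\<close>

lemma countable_compact_neighbourhood_base:
  assumes "second_countable X" "locally_compact_space X" "Hausdorff_space X"
  obtains B :: "nat \<Rightarrow> 'a set" where "\<And>n. compactin X (B n)"
    and "\<And>U x. openin X U \<Longrightarrow> x \<in> U \<Longrightarrow> \<exists>n V. openin X V \<and> x \<in> V \<and> V \<subseteq> B n \<and> B n \<subseteq> U"
proof -
  obtain \<O> where \<O>: "countable \<O>" "\<And>V. V \<in> \<O> \<Longrightarrow> openin X V"
    "\<And>U x. openin X U \<Longrightarrow> x \<in> U \<Longrightarrow> \<exists>V\<in>\<O>. x \<in> V \<and> V \<subseteq> U"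
    using assms(1) unfolding second_countable_def by meson
  \<comment> \<open>\<open>{}\<close> is added to make \<open>\<B>\<close> nonempty, as its
    enumeration by \<open>from_nat_into\<close> requires.\<close>
  define \<B> where "\<B> = insert {} {X closure_of V | V. V \<in> \<O> \<and> compactin X (X closure_of V)}"
  have "countable \<B>"
    using \<O>(1) unfolding \<B>_def
    by (simp add: setcompr_eq_image)
  moreover have "\<B> \<noteq> {}"
    by (simp add: \<B>_def)
  ultimately have range: "range (from_nat_into \<B>) = \<B>"
    by (simp add: range_from_nat_into)
  show thesis
  proof
    show "compactin X (from_nat_into \<B> n)" for n
      using from_nat_into[OF \<open>\<B> \<noteq> {}\<close>, of n] by (auto simp: \<B>_def)
    fix U x assume "openin X U" "x \<in> U"
    then obtain W K where WK: "openin X W" "compactin X K" "closedin X K" "x \<in> W" "W \<subseteq> K" "K \<subseteq> U"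
      using assms(2,3) locally_compact_space_neighbourhood_base_closedin[of X]
      unfolding neighbourhood_base_of by meson
    then obtain V where V: "V \<in> \<O>" "x \<in> V" "V \<subseteq> W"
      using \<O>(3) by meson
    have "X closure_of V \<subseteq> K"
      using V WK by (intro closure_of_minimal) auto
    then have "compactin X (X closure_of V)"
      using WK by (auto intro: closed_compactin)
    then have "X closure_of V \<in> range (from_nat_into \<B>)"
      unfolding range using V(1) by (auto simp: \<B>_def)
    then obtain n where n: "from_nat_into \<B> n = X closure_of V"
      by auto
    moreover have "V \<subseteq> X closure_of V"
      using \<O>(2)[OF V(1)] by (simp add: closure_of_subset openin_subset)
    ultimately show "\<exists>n V. openin X V \<and> x \<in> V \<and> V \<subseteq> from_nat_into \<B> n \<and> from_nat_into \<B> n \<subseteq> U"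
      using V \<O>(2)[OF V(1)] \<open>X closure_of V \<subseteq> K\<close> WK(6)
      by (intro exI[of _ n] exI[of _ V]) (auto simp: n)
  qed
qed

text \<open>
  In each class, intersect successively with those members of a separating sequence of
  compact sets that leave something over: a single point of the class survives.
\<close>

lemma Borel_transversal:
  fixes B :: "nat \<Rightarrow> 'a set"
  assumes X: "Hausdorff_space X"
    and B: "\<And>n. compactin X (B n)"
    and separating: "\<And>x y. x \<in> topspace X \<Longrightarrow> y \<in> topspace X \<Longrightarrow> x \<noteq> y \<Longrightarrow> \<exists>n. x \<in> B n \<and> y \<notin> B n"
    and A: "compactin X A" and E: "equiv A E" "compactin (prod_topology X X) E"
  obtains T where "T \<subseteq> A" "T \<in> borel_sets_of X"
    and "\<And>a. a \<in> A \<Longrightarrow> \<exists>t\<in>T. (a, t) \<in> E"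
    and "\<And>s t. s \<in> T \<Longrightarrow> t \<in> T \<Longrightarrow> (s, t) \<in> E \<Longrightarrow> s = t"
proof -
  interpret sigma_algebra "topspace X" "borel_sets_of X"
    by (rule sigma_algebra_borel_sets_of)
  have E_sub: "E \<subseteq> A \<times> A"
    using E(1) by (simp add: equiv_type)
  have A_sub: "A \<subseteq> topspace X"
    using A by (rule compactin_subset_topspace)
  have closedB: "closedin X (B n)" for n
    using compactin_imp_closedin[OF X B] .
  \<comment> \<open>\<open>E\<close> is compact, so projections of its closed parts are closed.
    Hence classes, and saturations of closed sets, are closed.\<close>
  have cfst: "closedin X (fst ` (E \<inter> (topspace X \<times> F)))" if "closedin X F" for F
    by (intro compactin_imp_closedin[OF X] image_compactin[OF _ continuous_map_fst[of X X]]
         compact_Int_closedin[OF E(2)]) (simp add: closedin_prod_Times_iff that)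
  have csnd: "closedin X (snd ` (E \<inter> (F \<times> topspace X)))" if "closedin X F" for F
    by (intro compactin_imp_closedin[OF X] image_compactin[OF _ continuous_map_snd[of X X]]
         compact_Int_closedin[OF E(2)]) (simp add: closedin_prod_Times_iff that)
  \<comment> \<open>\<open>K n a\<close> is what is left of the class of \<open>a\<close> after the
    sets \<open>B m\<close> with \<open>m < n\<close> have been tried. It depends on the class
    alone.\<close>
  define K where "K = rec_nat (\<lambda>a. E `` {a})
    (\<lambda>n k a. if k a \<inter> B n \<noteq> {} then k a \<inter> B n else k a)"
  have K0: "K 0 a = E `` {a}" for a
    by (simp add: K_def)
  have KSuc: "K (Suc n) a = (if K n a \<inter> B n \<noteq> {} then K n a \<inter> B n else K n a)" for n a
    by (simp add: K_def)
  have K_class: "K n a = K n b" if "(a, b) \<in> E" for a b n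
    using equiv_class_eq[OF E(1) that] by (induction n) (simp_all add: K0 KSuc)
  have K_dec: "decseq (\<lambda>n. K n a)" for a
    by (rule decseq_SucI) (simp add: KSuc)
  have K_sub: "K n a \<subseteq> E `` {a}" for n a
    using decseqD[OF K_dec, of 0 n a] by (simp add: K0)
  have K_closed: "closedin X (K n a)" if "a \<in> A" for n a
  proof (induction n)
    case 0
    have "E `` {a} = snd ` (E \<inter> ({a} \<times> topspace X))"
      using E_sub A_sub by force
    moreover have "closedin X {a}"
      using X A_sub that by (simp add: closedin_Hausdorff_singleton subsetD)
    ultimately show ?case
      using csnd[of "{a}"] by (simp add: K0)
  qed (simp add: KSuc closedin_Int closedB)
  have K_ne: "K n a \<noteq> {}" if "a \<in> A" for n a
  proof (induction n)
    case 0
    show ?case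
      using equiv_class_self[OF E(1) that] unfolding K0 by blast
  qed (simp add: KSuc)
  \<comment> \<open>The induction needs all closed \<open>F\<close> at once: the step to
    \<open>Suc n\<close> tests \<open>K n a\<close> against \<open>B n \<inter> F\<close> and
    \<open>B n\<close> besides \<open>F\<close>.\<close>
  have K_Borel: "{a \<in> A. K n a \<inter> F \<noteq> {}} \<in> borel_sets_of X" if "closedin X F" for n F
    using that
  proof (induction n arbitrary: F)
    case 0
    have "{a \<in> A. K 0 a \<inter> F \<noteq> {}} = fst ` (E \<inter> (topspace X \<times> F))"
      unfolding K0
    proof (intro set_eqI iffI)
      fix a assume "a \<in> {a \<in> A. E `` {a} \<inter> F \<noteq> {}}"
      then obtain b where "(a, b) \<in> E" "a \<in> A" "b \<in> F"
        by blast
      with A_sub show "a \<in> fst ` (E \<inter> (topspace X \<times> F))"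
        by (intro image_eqI[of _ _ "(a, b)"]) auto
    next
      fix a assume "a \<in> fst ` (E \<inter> (topspace X \<times> F))"
      then obtain b where "(a, b) \<in> E" "b \<in> F"
        by auto
      with E_sub show "a \<in> {a \<in> A. E `` {a} \<inter> F \<noteq> {}}"
        by blast
    qed
    then show ?case
      using cfst[OF 0] by (simp add: closedin_borel_sets_of)
  next
    case (Suc n)
    have "{a \<in> A. K (Suc n) a \<inter> F \<noteq> {}} = {a \<in> A. K n a \<inter> (B n \<inter> F) \<noteq> {}}
        \<union> ({a \<in> A. K n a \<inter> F \<noteq> {}} - {a \<in> A. K n a \<inter> B n \<noteq> {}})"
      by (auto simp: KSuc)
    then show ?case
      by (simp only:) (intro Un Diff Suc.IH closedin_Int closedB Suc.prems)
  qed
  \<comment> \<open>The condition at \<open>n\<close> reads: if \<open>B n\<close> meets what is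
    left of the class, then \<open>B n\<close> contains \<open>a\<close>. In this form
    \<open>T\<close> is visibly Borel; \<open>T_iff\<close> identifies it as the set of points
    surviving every step.\<close>
  define T where "T = (\<Inter>n. A - ({a \<in> A. K n a \<inter> B n \<noteq> {}} - B n))"
  have T_iff: "a \<in> T \<longleftrightarrow> a \<in> A \<and> (\<forall>n. a \<in> K n a)" for a
  proof (cases "a \<in> A")
    case True
    have "(\<forall>n. K n a \<inter> B n \<noteq> {} \<longrightarrow> a \<in> B n) \<longleftrightarrow> (\<forall>n. a \<in> K n a)" (is "?L \<longleftrightarrow> ?R")
    proof
      assume ?L
      show ?R
      proof
        show "a \<in> K n a" for n
          using \<open>?L\<close> equiv_class_self[OF E(1) True] by (induction n) (auto simp: K0 KSuc)
      qed
    next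
      assume R: ?R
      show ?L
      proof (intro allI impI)
        fix n assume "K n a \<inter> B n \<noteq> {}"
        then show "a \<in> B n"
          using R[rule_format, of "Suc n"] by (simp add: KSuc)
      qed
    qed
    with True show ?thesis
      by (auto simp: T_def)
  qed (auto simp: T_def)
  show thesis
  proof
    show "T \<subseteq> A"
      using T_iff by auto
    have "A \<in> borel_sets_of X" "\<And>n. B n \<in> borel_sets_of X"
      using A X closedB by (simp_all add: closedin_borel_sets_of compactin_imp_closedin)
    then show "T \<in> borel_sets_of X"
      unfolding T_def by (intro countable_INT image_subsetI Diff K_Borel closedB) auto
    show "\<exists>t\<in>T. (a, t) \<in> E" if a: "a \<in> A" for a
    proof -
      have "(\<Inter>n. K n a) \<noteq> {}"
      proof (rule compact_space_imp_nest)
        show "compact_space (subtopology X A)"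
          by (simp add: A compact_space_subtopology)
        show "closedin (subtopology X A) (K n a)" for n
          using K_closed[OF a] K_sub[of n a] E_sub by (intro closedin_subset_topspace) auto
      qed (use K_ne a K_dec in auto)
      then obtain t where t: "\<And>n. t \<in> K n a"
        by auto
      then have at: "(a, t) \<in> E"
        using t[of 0] by (simp add: K0)
      then have "t \<in> T"
        using t K_class[OF at] E_sub by (auto simp: T_iff)
      with at show ?thesis by blast
    qed
    show "s = t" if st: "s \<in> T" "t \<in> T" "(s, t) \<in> E" for s t
    proof (rule ccontr)
      assume "s \<noteq> t"
      then obtain n where n: "s \<in> B n" "t \<notin> B n"
        using separating st(1,2) T_iff A_sub by blast
      \<comment> \<open>\<open>s\<close> witnesses that \<open>B n\<close> meets
        \<open>K n s\<close>, so step \<open>n\<close> cuts down to \<open>B n\<close> and would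
        remove \<open>t\<close>, which survives all steps.\<close>
      have "s \<in> K n s" "t \<in> K (Suc n) s"
        using st T_iff K_class by blast+
      then show False
        using n by (auto simp: KSuc split: if_splits)
    qed
  qed
qed

section \<open>Orbits as equivalence classes, and quotients of arrows\<close>

lemma (in groupoid) orbit_subset_units: "x \<in> units G \<Longrightarrow> orbit G x \<subseteq> units G"
  by (auto simp: orbit_eq src_closed)

lemma (in groupoid) self_in_orbit: "x \<in> units G \<Longrightarrow> x \<in> orbit G x"
  using id_closed[of x] rng_id[of x] src_id[of x] by (auto simp: orbit_eq intro!: exI[of _ "gid G x"])

lemma (in groupoid) orbit_sym:
  assumes "x \<in> units G" "y \<in> orbit G x"
  shows "x \<in> orbit G y"
proof -
  obtain g where "g \<in> arrows G" "grng G g = x" "gsrc G g = y"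
    using assms by (auto simp: orbit_eq)
  then show ?thesis
    using orbit_eq[of y] src_closed inv_closed[of g] rng_inv[of g] src_inv[of g] by fastforce
qed

lemma (in groupoid) orbit_trans:
  assumes "x \<in> units G" "y \<in> orbit G x" "z \<in> orbit G y"
  shows "z \<in> orbit G x"
proof -
  have y: "y \<in> units G"
    using assms orbit_subset_units by auto
  obtain g where g: "g \<in> arrows G" "grng G g = x" "gsrc G g = y"
    using assms by (auto simp: orbit_eq)
  obtain h where h: "h \<in> arrows G" "grng G h = y" "gsrc G h = z"
    using assms y by (auto simp: orbit_eq)
  have "(g, h) \<in> composable G"
    using g h by (simp add: composable_def)
  then have "gmult G g h \<in> arrows G" "grng G (gmult G g h) = x" "gsrc G (gmult G g h) = z"
    using g h by (simp_all add: mult_closed rng_mult src_mult)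
  then show ?thesis
    using assms(1) by (auto simp: orbit_eq)
qed

text \<open>Used for arrows with a common range. It is a unit exactly for \<open>g = h\<close> and,
  by continuity, close to the units when \<open>h\<close> is close to \<open>g\<close>.\<close>

definition quot :: "('g, 'x, 'm) top_groupoid_scheme \<Rightarrow> 'g \<Rightarrow> 'g \<Rightarrow> 'g" where
  "quot G g h = gmult G (ginv G g) h"

context groupoid
begin

lemma quot:
  assumes "g \<in> arrows G" "h \<in> arrows G" "grng G g = grng G h"
  shows rng_quot: "grng G (quot G g h) = gsrc G g"
    and src_quot: "gsrc G (quot G g h) = gsrc G h"
proof -
  have "(ginv G g, h) \<in> composable G"
    using assms by (simp add: composable_def inv_closed src_inv)
  then show "grng G (quot G g h) = gsrc G g" "gsrc G (quot G g h) = gsrc G h"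
    using assms rng_mult src_mult rng_inv by (simp_all add: quot_def)
qed

lemma quot_self: "g \<in> arrows G \<Longrightarrow> quot G g g = gid G (gsrc G g)"
  by (simp add: quot_def inv_left)

text \<open>Multiplying \<open>quot G g h\<close> by \<open>g\<close> on the left gives
  \<open>h\<close>; if the quotient is a unit, the same product is \<open>g\<close>.\<close>

lemma quot_unit_imp_eq:
  assumes "g \<in> arrows G" "h \<in> arrows G" "grng G g = grng G h"
    and "quot G g h \<in> gid G ` units G"
  shows "g = h"
proof -
  obtain x where x: "x \<in> units G" "quot G g h = gid G x"
    using assms(4) by auto
  then have "x = gsrc G g"
    using rng_quot[OF assms(1-3)] rng_id by simp
  have "(g, ginv G g) \<in> composable G" "(ginv G g, h) \<in> composable G"
    using assms by (simp_all add: composable_def inv_closed rng_inv src_inv)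
  then have "gmult G g (quot G g h) = gmult G (gmult G g (ginv G g)) h"
    by (simp add: quot_def mult_assoc)
  also have "\<dots> = h"
    using assms by (simp add: inv_right id_left)
  finally show ?thesis
    using x \<open>x = gsrc G g\<close> id_right[OF assms(1)] by simp
qed

end

section \<open>Hausdorffness and small neighbourhoods in the space of arrows\<close>

locale lc_groupoid = continuous_groupoid +
  assumes second_countable_units: "second_countable (unit_top G)"
    and locally_compact_units: "locally_compact_space (unit_top G)"
    and Hausdorff_units: "Hausdorff_space (unit_top G)"
    and second_countable_arrows: "second_countable (arr_top G)"
    and locally_compact_arrows: "locally_compact_space (arr_top G)"
    and closed_units: "closedin (arr_top G) (gid G ` units G)"
    and continuous_id: "continuous_map (unit_top G) (arr_top G) (gid G)"
begin

abbreviation "fibre \<equiv> {(g, h). g \<in> arrows G \<and> h \<in> arrows G \<and> grng G g = grng G h}"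

lemma closed_fibre: "closedin (prod_topology (arr_top G) (arr_top G)) fibre"
proof -
  have "closedin (prod_topology (arr_top G) (arr_top G))
      {p \<in> topspace (prod_topology (arr_top G) (arr_top G)). (grng G \<circ> fst) p = (grng G \<circ> snd) p}"
    by (intro closedin_continuous_maps_eq[OF Hausdorff_units] continuous_map_compose[OF _ continuous_rng]
        continuous_map_fst continuous_map_snd)
  also have "{p \<in> topspace (prod_topology (arr_top G) (arr_top G)). (grng G \<circ> fst) p = (grng G \<circ> snd) p} = fibre"
    by (auto simp: arrows_def)
  finally show ?thesis .
qed

lemma closed_composable: "closedin (prod_topology (arr_top G) (arr_top G)) (composable G)"
proof -
  have "closedin (prod_topology (arr_top G) (arr_top G))
      {p \<in> topspace (prod_topology (arr_top G) (arr_top G)). (gsrc G \<circ> fst) p = (grng G \<circ> snd) p}"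
    by (intro closedin_continuous_maps_eq[OF Hausdorff_units] continuous_map_compose[OF _ continuous_rng]
        continuous_map_compose[OF _ continuous_src] continuous_map_fst continuous_map_snd)
  also have "{p \<in> topspace (prod_topology (arr_top G) (arr_top G)). (gsrc G \<circ> fst) p = (grng G \<circ> snd) p} = composable G"
    by (auto simp: arrows_def composable_def)
  finally show ?thesis .
qed

lemma continuous_quot:
  "continuous_map (subtopology (prod_topology (arr_top G) (arr_top G)) fibre) (arr_top G)
     (\<lambda>(g, h). quot G g h)"
proof -
  have "continuous_map (subtopology (prod_topology (arr_top G) (arr_top G)) fibre)
      (prod_topology (arr_top G) (arr_top G)) (\<lambda>p. ((ginv G \<circ> fst) p, snd p))"
    by (intro continuous_map_from_subtopology continuous_map_pairedI
        continuous_map_compose[OF _ continuous_inv] continuous_map_fst continuous_map_snd)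
  then have "continuous_map (subtopology (prod_topology (arr_top G) (arr_top G)) fibre)
      (subtopology (prod_topology (arr_top G) (arr_top G)) (composable G)) (\<lambda>p. ((ginv G \<circ> fst) p, snd p))"
    by (rule continuous_map_into_subtopology) (auto simp: composable_def inv_closed src_inv)
  from continuous_map_compose[OF this continuous_mult] show ?thesis
    by (simp add: o_def quot_def case_prod_unfold)
qed

text \<open>The diagonal is the preimage of the closed unit space under \<open>(g, h) \<mapsto> g\<^sup>-\<^sup>1 h\<close>.\<close>

lemma Hausdorff_arrows: "Hausdorff_space (arr_top G)"
proof -
  let ?P = "subtopology (prod_topology (arr_top G) (arr_top G)) fibre"
  have "closedin ?P {p \<in> topspace ?P. (\<lambda>(g, h). quot G g h) p \<in> gid G ` units G}"
    by (rule closedin_continuous_map_preimage[OF continuous_quot closed_units])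
  also have "{p \<in> topspace ?P. (\<lambda>(g, h). quot G g h) p \<in> gid G ` units G}
      = (\<lambda>g. (g, g)) ` topspace (arr_top G)"
    using quot_unit_imp_eq src_closed by (auto simp: arrows_def quot_self)
  finally show ?thesis
    using closed_fibre by (simp add: Hausdorff_space_closedin_diagonal closedin_trans_full)
qed

text \<open>\<open>quot G g g\<close> is a unit, hence in \<open>U\<close>, so by continuity pairs
  in \<open>fibre\<close> close to \<open>(g, g)\<close> have quotients in \<open>U\<close>. A box
  around \<open>(g, g)\<close> is then shrunk to a compact neighbourhood of
  \<open>g\<close>.\<close>

lemma ex_small_quot_neighbourhood:
  assumes U: "openin (arr_top G) U" "gid G ` units G \<subseteq> U" and g: "g \<in> arrows G"
  obtains V D where "openin (arr_top G) V" "g \<in> V" "V \<subseteq> D" "compactin (arr_top G) D"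
    and "\<And>a b. a \<in> D \<Longrightarrow> b \<in> D \<Longrightarrow> grng G a = grng G b \<Longrightarrow> quot G a b \<in> U"
proof -
  let ?P = "subtopology (prod_topology (arr_top G) (arr_top G)) fibre"
  have "openin ?P {p \<in> topspace ?P. (\<lambda>(g, h). quot G g h) p \<in> U}"
    by (rule openin_continuous_map_preimage[OF continuous_quot U(1)])
  then obtain W where W: "openin (prod_topology (arr_top G) (arr_top G)) W"
    "{p \<in> topspace ?P. (\<lambda>(g, h). quot G g h) p \<in> U} = W \<inter> fibre"
    unfolding openin_subtopology by auto
  have "(g, g) \<in> {p \<in> topspace ?P. (\<lambda>(g, h). quot G g h) p \<in> U}"
    using g U(2) src_closed by (auto simp: quot_self arrows_def)
  then have "(g, g) \<in> W"
    unfolding W(2) by (rule IntD1)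
  then obtain V1 V2 where V12: "openin (arr_top G) V1" "openin (arr_top G) V2" "g \<in> V1" "g \<in> V2"
    "V1 \<times> V2 \<subseteq> W"
    using W(1)[unfolded openin_prod_topology_alt, rule_format, of g g] by auto
  then have "openin (arr_top G) (V1 \<inter> V2)" "g \<in> V1 \<inter> V2"
    by auto
  then obtain V D where VD: "openin (arr_top G) V" "compactin (arr_top G) D" "g \<in> V" "V \<subseteq> D" "D \<subseteq> V1 \<inter> V2"
    using locally_compact_arrows
    unfolding locally_compact_space_neighbourhood_base[OF disjI1[OF Hausdorff_arrows]]
      neighbourhood_base_of by meson
  show thesis
  proof
    fix a b assume "a \<in> D" "b \<in> D" "grng G a = grng G b"
    then have "(a, b) \<in> W \<inter> fibre"
      using VD V12 compactin_subset_topspace[OF VD(2)] by (auto simp: arrows_def)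
    then show "quot G a b \<in> U"
      unfolding W(2)[symmetric] by simp
  qed (fact VD)+
qed

text \<open>A plain union of relatively compact neighbourhoods of the identities over the
  \<open>C n\<close> could have infinitely many members contributing arrows over one
  \<open>C n\<close>. Restricting the member of index \<open>m\<close> to ranges outside all earlier
  \<open>C k\<close> leaves only the indices \<open>m \<le> n\<close> over
  \<open>C n\<close>.\<close>

lemma ex_open_unit_neighbourhood:
  fixes C :: "nat \<Rightarrow> 'b set"
  assumes C: "\<And>n. compactin (unit_top G) (C n)" "(\<Union>n. C n) = units G"
  obtains U M where "openin (arr_top G) U" "gid G ` units G \<subseteq> U"
    "\<And>n. compactin (arr_top G) (M n)" "\<And>n. gid G ` C n \<subseteq> M n"
    "\<And>n g. g \<in> U \<Longrightarrow> grng G g \<in> C n \<Longrightarrow> g \<in> M n"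
proof -
  have "\<exists>V Q. openin (arr_top G) V \<and> compactin (arr_top G) Q \<and> gid G ` C n \<subseteq> V \<and> V \<subseteq> Q" for n
    using image_compactin[OF C(1) continuous_id, of n] locally_compact_arrows
      locally_compact_space_compact_closed_compact Hausdorff_arrows by metis
  then obtain V Q where VQ: "\<And>n. openin (arr_top G) (V n)" "\<And>n. compactin (arr_top G) (Q n)"
    "\<And>n. gid G ` C n \<subseteq> V n" "\<And>n. V n \<subseteq> Q n"
    by metis
  define R where "R n = units G - (\<Union>m<n. C m)" for n
  have R: "openin (unit_top G) (R n)" for n
    unfolding R_def units_def using C(1) Hausdorff_units
    by (intro openin_diff closedin_Union) (auto intro: compactin_imp_closedin)
  define U where "U = (\<Union>n. {g \<in> V n. grng G g \<in> R n})"
  show thesis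
  proof
    show "openin (arr_top G) U"
      unfolding U_def
      by (intro openin_Union ballI) (auto intro: openin_continuous_map_preimage_gen[OF continuous_rng VQ(1) R])
    show "gid G ` units G \<subseteq> U"
    proof clarify
      fix x assume x: "x \<in> units G"
      \<comment> \<open>With the least such index, \<open>x\<close> avoids all earlier sets, so the
        restriction to \<open>R n\<close> keeps the identity at \<open>x\<close>.\<close>
      then obtain n where n: "x \<in> C n" "\<And>m. m < n \<Longrightarrow> x \<notin> C m"
        using C(2) exists_least_iff[of "\<lambda>n. x \<in> C n"] by auto
      then have "gid G x \<in> V n" "grng G (gid G x) \<in> R n"
        using VQ(3) x by (auto simp: R_def rng_id)
      then show "gid G x \<in> U"
        by (auto simp: U_def)
    qed
    show "compactin (arr_top G) (\<Union>m\<le>n. Q m)" for n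
      using VQ(2) by (intro compactin_Union) auto
    show "gid G ` C n \<subseteq> (\<Union>m\<le>n. Q m)" for n
      using VQ(3,4)[of n] by blast
    show "g \<in> (\<Union>m\<le>n. Q m)" if g: "g \<in> U" "grng G g \<in> C n" for n g
    proof -
      obtain m where "g \<in> V m" "grng G g \<in> R m"
        using g(1) by (auto simp: U_def)
      then have "m \<le> n" "g \<in> Q m"
        using g(2) VQ(4) by (auto simp: R_def not_less[symmetric])
      then show ?thesis by auto
    qed
  qed
qed

end

section \<open>Nearness of units and the pieces on which it is an equivalence relation\<close>

text \<open>The set of arrows is a parameter because nearness through the open \<open>U\<close> is
  later identified with nearness through a compact set.\<close>

definition near :: "('g, 'x, 'm) top_groupoid_scheme \<Rightarrow> 'g set \<Rightarrow> 'x set \<Rightarrow> ('x \<times> 'x) set" where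
  "near G U A = {(grng G g, gsrc G g) | g. g \<in> U \<and> grng G g \<in> A \<and> gsrc G g \<in> A}"

lemma nearI: "g \<in> U \<Longrightarrow> grng G g \<in> A \<Longrightarrow> gsrc G g \<in> A \<Longrightarrow> (grng G g, gsrc G g) \<in> near G U A"
  by (auto simp: near_def)

lemma nearE:
  assumes "p \<in> near G U A"
  obtains g where "g \<in> U" "grng G g \<in> A" "gsrc G g \<in> A" "p = (grng G g, gsrc G g)"
  using assms by (auto simp: near_def)

context lc_groupoid
begin

lemma continuous_endpoints:
  "continuous_map (arr_top G) (prod_topology (unit_top G) (unit_top G)) (\<lambda>g. (grng G g, gsrc G g))"
  by (intro continuous_map_pairedI continuous_rng continuous_src)

lemma compactin_near:
  assumes M: "compactin (arr_top G) M" and A: "closedin (unit_top G) A"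
  shows "compactin (prod_topology (unit_top G) (unit_top G)) (near G M A)"
proof -
  let ?R = "{g \<in> topspace (arr_top G). grng G g \<in> A}" and ?S = "{g \<in> topspace (arr_top G). gsrc G g \<in> A}"
  have "closedin (arr_top G) (?R \<inter> ?S)"
    by (intro closedin_Int closedin_continuous_map_preimage[OF continuous_rng A]
        closedin_continuous_map_preimage[OF continuous_src A])
  then have "compactin (arr_top G) (M \<inter> (?R \<inter> ?S))"
    by (rule compact_Int_closedin[OF M])
  moreover have "near G M A = (\<lambda>g. (grng G g, gsrc G g)) ` (M \<inter> (?R \<inter> ?S))"
    using compactin_subset_topspace[OF M] by (auto simp: near_def)
  ultimately show ?thesis
    by (simp only:) (rule image_compactin[OF _ continuous_endpoints])
qed

text \<open>Composable pairs form a closed set, so those in \<open>M \<times> N\<close> form a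
  compact one, and multiplication maps it onto the product set.\<close>

lemma compactin_mult:
  assumes "compactin (arr_top G) M" "compactin (arr_top G) N"
  shows "compactin (arr_top G) (arrow_prod G M N)"
proof -
  let ?P = "subtopology (prod_topology (arr_top G) (arr_top G)) (composable G)"
  have "compactin ?P ((M \<times> N) \<inter> composable G)"
    using assms closed_composable
    by (intro compact_imp_compactin_subtopology compact_Int_closedin) (auto simp: compactin_Times)
  then have "compactin (arr_top G) ((\<lambda>(g, h). gmult G g h) ` ((M \<times> N) \<inter> composable G))"
    using continuous_mult by (rule image_compactin)
  also have "(\<lambda>(g, h). gmult G g h) ` ((M \<times> N) \<inter> composable G) = arrow_prod G M N"
  proof (intro set_eqI iffI)
    fix k assume "k \<in> arrow_prod G M N"
    then obtain g h where gh: "g \<in> M" "h \<in> N" "gsrc G g = grng G h" "k = gmult G g h"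
      by (auto simp: arrow_prod_def)
    then have "(g, h) \<in> (M \<times> N) \<inter> composable G"
      using assms[THEN compactin_subset_topspace] by (auto simp: composable_def arrows_def)
    then show "k \<in> (\<lambda>(g, h). gmult G g h) ` ((M \<times> N) \<inter> composable G)"
      unfolding gh(4) by (rule rev_image_eqI) simp
  qed (auto simp: arrow_prod_def composable_def)
  finally show ?thesis .
qed

text \<open>
  \<open>F V\<close> consists of the units whose isotropy group meets a given small compact set of arrows.
  If the isotropy of every point of \<open>A\<close> meets all the small pieces that the isotropy of \<open>x\<close>
  meets, an arrow \<open>g \<in> K\<close> between two points of \<open>A\<close> near \<open>x\<close>, being close to the isotropy of \<open>x\<close>,
  is close to an isotropy arrow \<open>a\<close> at its range, and \<open>a\<^sup>-\<^sup>1 g \<in> U\<close> has the same end points.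
\<close>

lemma isotropy_control:
  assumes U: "openin (arr_top G) U" "gid G ` units G \<subseteq> U" and K: "compactin (arr_top G) K"
  obtains \<F> and F :: "'a set \<Rightarrow> 'b set" where "finite \<F>" "\<forall>V\<in>\<F>. closedin (unit_top G) (F V)"
    and "\<forall>x\<in>units G. \<exists>W. openin (unit_top G) W \<and> x \<in> W \<and>
      (\<forall>g\<in>K. grng G g \<in> W \<longrightarrow> gsrc G g \<in> W \<longrightarrow> (\<forall>V\<in>\<F>. x \<in> F V \<longrightarrow> grng G g \<in> F V) \<longrightarrow>
         (\<exists>h\<in>U. grng G h = grng G g \<and> gsrc G h = gsrc G g))"
proof -
  define small where "small D \<longleftrightarrow> compactin (arr_top G) D \<and>
    (\<forall>a\<in>D. \<forall>b\<in>D. grng G a = grng G b \<longrightarrow> quot G a b \<in> U)" for D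
  let ?\<V> = "{V. openin (arr_top G) V \<and> (\<exists>D. V \<subseteq> D \<and> small D)}"
  have "K \<subseteq> \<Union>?\<V>"
  proof
    fix g assume "g \<in> K"
    then have "g \<in> arrows G"
      using compactin_subset_topspace[OF K] by (auto simp: arrows_def)
    then obtain V D where "openin (arr_top G) V" "g \<in> V" "V \<subseteq> D" "small D"
      unfolding small_def by (rule ex_small_quot_neighbourhood[OF U]) blast
    then show "g \<in> \<Union>?\<V>"
      by blast
  qed
  then obtain \<F> where \<F>: "finite \<F>" "\<F> \<subseteq> ?\<V>" "K \<subseteq> \<Union>\<F>"
    using K unfolding compactin_def by (metis (no_types, lifting) mem_Collect_eq)
  then have "\<forall>V\<in>\<F>. \<exists>D. V \<subseteq> D \<and> small D"
    by blast
  then obtain D where D: "\<And>V. V \<in> \<F> \<Longrightarrow> V \<subseteq> D V" "\<And>V. V \<in> \<F> \<Longrightarrow> small (D V)"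
    by metis
  \<comment> \<open>Using the compact \<open>D V\<close> rather than the open \<open>V\<close> makes
    \<open>F V\<close> closed, while quotients of arrows of \<open>D V\<close> with the same range
    still lie in \<open>U\<close>.\<close>
  define F where "F V = grng G ` {g \<in> D V. grng G g = gsrc G g}" for V
  show thesis
  proof
    show "finite \<F>" by fact
    show "\<forall>V\<in>\<F>. closedin (unit_top G) (F V)"
    proof
      fix V assume "V \<in> \<F>"
      have DV: "compactin (arr_top G) (D V)"
        using D(2)[OF \<open>V \<in> \<F>\<close>] by (simp add: small_def)
      have "{g \<in> D V. grng G g = gsrc G g} = D V \<inter> {g \<in> topspace (arr_top G). grng G g = gsrc G g}"
        using compactin_subset_topspace[OF DV] by auto
      then have "compactin (arr_top G) {g \<in> D V. grng G g = gsrc G g}"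
        using compact_Int_closedin[OF DV closedin_continuous_maps_eq[OF Hausdorff_units continuous_rng continuous_src]]
        by simp
      then show "closedin (unit_top G) (F V)"
        unfolding F_def by (intro compactin_imp_closedin[OF Hausdorff_units] image_compactin[OF _ continuous_rng])
    qed
    show "\<forall>x\<in>units G. \<exists>W. openin (unit_top G) W \<and> x \<in> W \<and>
      (\<forall>g\<in>K. grng G g \<in> W \<longrightarrow> gsrc G g \<in> W \<longrightarrow> (\<forall>V\<in>\<F>. x \<in> F V \<longrightarrow> grng G g \<in> F V) \<longrightarrow>
         (\<exists>h\<in>U. grng G h = grng G g \<and> gsrc G h = gsrc G g))"
    proof
      fix x assume x: "x \<in> units G"
      \<comment> \<open>\<open>N\<close> is open and contains every isotropy arrow of
        \<open>x\<close> in \<open>K\<close>. The end points of the rest of \<open>K\<close> form a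
        compact set \<open>P\<close> missing \<open>(x, x)\<close>, so an arrow of \<open>K\<close>
        with both end points close enough to \<open>x\<close> lies in \<open>N\<close>.\<close>
      define N where "N = \<Union>{V \<in> \<F>. x \<in> F V}"
      define P where "P = (\<lambda>g. (grng G g, gsrc G g)) ` (K - N)"
      have "openin (arr_top G) N"
        using \<F>(2) by (auto simp: N_def)
      then have "compactin (arr_top G) (K \<inter> (topspace (arr_top G) - N))"
        by (intro compact_Int_closedin[OF K] closedin_diff) auto
      moreover have "K \<inter> (topspace (arr_top G) - N) = K - N"
        using compactin_subset_topspace[OF K] by auto
      ultimately have "compactin (prod_topology (unit_top G) (unit_top G)) P"
        unfolding P_def using image_compactin[OF _ continuous_endpoints] by metis
      then have "closedin (prod_topology (unit_top G) (unit_top G)) P"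
        using Hausdorff_units by (intro compactin_imp_closedin) (auto simp: Hausdorff_space_prod_topology)
      then have openP: "openin (prod_topology (unit_top G) (unit_top G)) (units G \<times> units G - P)"
        by (auto simp: closedin_def units_def)
      have "(x, x) \<notin> P"
      proof
        assume "(x, x) \<in> P"
        then obtain g where g: "g \<in> K" "g \<notin> N" "grng G g = x" "gsrc G g = x"
          by (auto simp: P_def)
        then obtain V where V: "V \<in> \<F>" "g \<in> V"
          using \<F>(3) by auto
        then have "g \<in> {g \<in> D V. grng G g = gsrc G g}"
          using D(1) g by auto
        then have "x \<in> F V"
          unfolding F_def g(3)[symmetric] by (rule imageI)
        with V g(2) show False
          by (auto simp: N_def)
      qed
      then obtain W1 W2 where W: "openin (unit_top G) W1" "openin (unit_top G) W2" "x \<in> W1" "x \<in> W2"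
        "W1 \<times> W2 \<subseteq> units G \<times> units G - P"
        using openP[unfolded openin_prod_topology_alt, rule_format, of x x] x by auto
      have "\<exists>h\<in>U. grng G h = grng G g \<and> gsrc G h = gsrc G g"
        if g: "g \<in> K" "grng G g \<in> W1" "gsrc G g \<in> W2" "\<And>V. V \<in> \<F> \<Longrightarrow> x \<in> F V \<Longrightarrow> grng G g \<in> F V" for g
      proof -
        have "(grng G g, gsrc G g) \<notin> P"
          using W(5) g(2,3) by blast
        then have "g \<in> N"
          using g(1) by (auto simp: P_def)
        then obtain V where V: "V \<in> \<F>" "x \<in> F V" "g \<in> V"
          by (auto simp: N_def)
        then have "grng G g \<in> F V"
          using g(4) by blast
        then obtain a where a: "a \<in> D V" "grng G a = gsrc G a" "grng G a = grng G g"
          unfolding F_def by auto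
        have "g \<in> D V" "small (D V)"
          using V D by auto
        then have "quot G a g \<in> U" "D V \<subseteq> arrows G"
          using a compactin_subset_topspace by (auto simp: small_def arrows_def)
        moreover from this have "a \<in> arrows G" "g \<in> arrows G"
          using a \<open>g \<in> D V\<close> by auto
        ultimately show ?thesis
          using a rng_quot src_quot by (intro bexI[of _ "quot G a g"]) simp_all
      qed
      then show "\<exists>W. openin (unit_top G) W \<and> x \<in> W \<and>
        (\<forall>g\<in>K. grng G g \<in> W \<longrightarrow> gsrc G g \<in> W \<longrightarrow> (\<forall>V\<in>\<F>. x \<in> F V \<longrightarrow> grng G g \<in> F V) \<longrightarrow>
           (\<exists>h\<in>U. grng G h = grng G g \<and> gsrc G h = gsrc G g))"
        using W by (intro exI[of _ "W1 \<inter> W2"]) auto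
    qed
  qed
qed

text \<open>
  For \<open>K = M\<^sup>-\<^sup>1 \<union> M M \<union> M\<close>, reducing arrows in \<open>K\<close> to arrows in \<open>U\<close> with the same end points
  makes nearness symmetric and transitive, and identifies it with its compact version for \<open>M\<close>.
\<close>

lemma ex_cover_near_equiv:
  assumes U: "openin (arr_top G) U" "gid G ` units G \<subseteq> U"
    and C: "compactin (unit_top G) C" and M: "compactin (arr_top G) M" "gid G ` C \<subseteq> M"
    and UM: "\<And>g. g \<in> U \<Longrightarrow> grng G g \<in> C \<Longrightarrow> g \<in> M"
  obtains \<A> where "countable \<A>" "C \<subseteq> \<Union>\<A>" "\<And>A. A \<in> \<A> \<Longrightarrow> compactin (unit_top G) A"
    and "\<And>A. A \<in> \<A> \<Longrightarrow> equiv A (near G U A)"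
    and "\<And>A. A \<in> \<A> \<Longrightarrow> compactin (prod_topology (unit_top G) (unit_top G)) (near G U A)"
proof -
  obtain B :: "nat \<Rightarrow> 'b set" where B: "\<And>n. compactin (unit_top G) (B n)"
    "\<And>U x. openin (unit_top G) U \<Longrightarrow> x \<in> U \<Longrightarrow>
      \<exists>n V. openin (unit_top G) V \<and> x \<in> V \<and> V \<subseteq> B n \<and> B n \<subseteq> U"
    using countable_compact_neighbourhood_base[OF second_countable_units locally_compact_units Hausdorff_units]
    by blast
  define K where "K = ginv G ` M \<union> arrow_prod G M M \<union> M"
  have "compactin (arr_top G) K"
    unfolding K_def by (intro compactin_Un compactin_mult image_compactin[OF _ continuous_inv] M(1))
  then obtain \<F> and F :: "'a set \<Rightarrow> 'b set" where F: "finite \<F>" "\<forall>V\<in>\<F>. closedin (unit_top G) (F V)"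
    "\<forall>x\<in>units G. \<exists>W. openin (unit_top G) W \<and> x \<in> W \<and>
      (\<forall>g\<in>K. grng G g \<in> W \<longrightarrow> gsrc G g \<in> W \<longrightarrow> (\<forall>V\<in>\<F>. x \<in> F V \<longrightarrow> grng G g \<in> F V) \<longrightarrow>
         (\<exists>h\<in>U. grng G h = grng G g \<and> gsrc G h = gsrc G g))"
    by (rule isotropy_control[OF U])
  have M_arr: "M \<subseteq> arrows G" and C_units: "C \<subseteq> units G"
    using M(1) C by (auto simp: arrows_def units_def dest: compactin_subset_topspace)
  \<comment> \<open>The factor \<open>units G\<close> matters when \<open>\<S>\<close> is empty,
    since the intersection of the empty family is the whole type.\<close>
  define piece where "piece n \<S> = B n \<inter> C \<inter> (units G \<inter> \<Inter>(F ` \<S>))" for n \<S>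
  define reducible where "reducible A \<longleftrightarrow> (\<forall>g\<in>K. grng G g \<in> A \<longrightarrow> gsrc G g \<in> A \<longrightarrow>
    (\<exists>h\<in>U. grng G h = grng G g \<and> gsrc G h = gsrc G g))" for A
  \<comment> \<open>Countability and compactness hold for all pieces. Keeping only the reducible
    ones shifts the work to showing that they still cover \<open>C\<close>.\<close>
  define \<A> where "\<A> = {A \<in> (\<lambda>(n, \<S>). piece n \<S>) ` (UNIV \<times> Pow \<F>). reducible A}"
  have A_sub: "A \<subseteq> C" and A_red: "reducible A" if "A \<in> \<A>" for A
    using that by (auto simp: \<A>_def piece_def)
  have A_comp: "compactin (unit_top G) A" if A_in: "A \<in> \<A>" for A
  proof -
    obtain n \<S> where A: "A = piece n \<S>" "\<S> \<subseteq> \<F>"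
      using A_in by (auto simp: \<A>_def)
    have "closedin (unit_top G) (units G \<inter> \<Inter>(F ` \<S>))"
    proof (cases "\<S> = {}")
      case False
      then have "closedin (unit_top G) (\<Inter>(F ` \<S>))"
        using A(2) F(2) by (intro closedin_Inter) auto
      then show ?thesis
        by (intro closedin_Int) (auto simp: units_def)
    qed (simp add: units_def)
    then show ?thesis
      unfolding A(1) piece_def
      by (intro compact_Int_closedin compactin_Int[OF Hausdorff_units B(1) C])
  qed
  have reduce: "(grng G g, gsrc G g) \<in> near G U A"
    if g: "A \<in> \<A>" "g \<in> K" "grng G g \<in> A" "gsrc G g \<in> A" for g A
  proof -
    obtain h where "h \<in> U" "grng G h = grng G g" "gsrc G h = gsrc G g"
      using A_red[OF g(1)] g(2-4) unfolding reducible_def by blast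
    then show ?thesis
      using nearI[of h U G A] g(3,4) by simp
  qed
  \<comment> \<open>Nearness thereby becomes compact, and symmetry and transitivity can start from
    arrows of \<open>M\<close>, whose inverses and products lie in \<open>K\<close>.\<close>
  have near_M: "near G U A = near G M A" if A: "A \<in> \<A>" for A
  proof (intro set_eqI iffI)
    fix p assume "p \<in> near G U A"
    then show "p \<in> near G M A"
      by (rule nearE) (use A_sub[OF A] UM in \<open>auto intro: nearI\<close>)
  next
    fix p assume "p \<in> near G M A"
    then show "p \<in> near G U A"
      by (rule nearE) (use reduce[OF A] in \<open>auto simp: K_def\<close>)
  qed
  show thesis
  proof
    show "countable \<A>"
      unfolding \<A>_def by (intro countable_Collect countable_image countable_SIGMA) (simp_all add: F(1) countable_finite)
    show "C \<subseteq> \<Union>\<A>"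
    proof
      fix x assume x: "x \<in> C"
      then have "x \<in> units G"
        using C_units by blast
      then obtain W where W: "openin (unit_top G) W" "x \<in> W"
        "\<And>g. g \<in> K \<Longrightarrow> grng G g \<in> W \<Longrightarrow> gsrc G g \<in> W \<Longrightarrow> (\<forall>V\<in>\<F>. x \<in> F V \<longrightarrow> grng G g \<in> F V) \<Longrightarrow>
         \<exists>h\<in>U. grng G h = grng G g \<and> gsrc G h = gsrc G g"
        using bspec[OF F(3)] by metis
      obtain n where n: "x \<in> B n" "B n \<subseteq> W"
        using B(2)[OF W(1,2)] by blast
      \<comment> \<open>Taking every \<open>V\<close> with \<open>x \<in> F V\<close> forces each
        point of the piece to satisfy all the isotropy conditions that \<open>x\<close> satisfies,
        which is the premise in \<open>W(3)\<close>.\<close>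
      let ?\<S> = "{V \<in> \<F>. x \<in> F V}"
      have "reducible (piece n ?\<S>)"
        unfolding reducible_def
      proof (intro ballI impI)
        fix g assume "g \<in> K" "grng G g \<in> piece n ?\<S>" "gsrc G g \<in> piece n ?\<S>"
        then show "\<exists>h\<in>U. grng G h = grng G g \<and> gsrc G h = gsrc G g"
          using n(2) by (intro W(3)) (auto simp: piece_def)
      qed
      then have "piece n ?\<S> \<in> \<A>"
        unfolding \<A>_def by (intro CollectI conjI image_eqI[of _ _ "(n, ?\<S>)"]) auto
      moreover have "x \<in> piece n ?\<S>"
        using x n \<open>x \<in> units G\<close> by (auto simp: piece_def)
      ultimately show "x \<in> \<Union>\<A>"
        by blast
    qed
    fix A assume A: "A \<in> \<A>"
    show "compactin (unit_top G) A"
      using A_comp[OF A] .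
    then show "compactin (prod_topology (unit_top G) (unit_top G)) (near G U A)"
      unfolding near_M[OF A] by (intro compactin_near M(1) compactin_imp_closedin[OF Hausdorff_units])
    show "equiv A (near G U A)"
    proof (rule equivI)
      show "near G U A \<subseteq> A \<times> A"
        by (auto simp: near_def)
      show "refl_on A (near G U A)"
      proof (rule refl_onI)
        fix x assume x: "x \<in> A"
        then have "x \<in> units G"
          using A_sub[OF A] C_units by blast
        then show "(x, x) \<in> near G U A"
          using nearI[of "gid G x" U G A] U(2) x by (auto simp: rng_id src_id)
      qed
      show "sym (near G U A)"
      proof (rule symI)
        fix x y assume "(x, y) \<in> near G U A"
        then obtain g where g: "g \<in> M" "grng G g \<in> A" "gsrc G g \<in> A" "x = grng G g" "y = gsrc G g"
          unfolding near_M[OF A] by (auto elim: nearE)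
        then show "(y, x) \<in> near G U A"
          using reduce[OF A, of "ginv G g"] M_arr by (auto simp: K_def rng_inv src_inv)
      qed
      show "trans (near G U A)"
      proof (rule transI)
        fix x y z assume "(x, y) \<in> near G U A" "(y, z) \<in> near G U A"
        then obtain g h where gh: "g \<in> M" "grng G g \<in> A" "gsrc G g \<in> A" "x = grng G g" "y = gsrc G g"
          "h \<in> M" "grng G h \<in> A" "gsrc G h \<in> A" "y = grng G h" "z = gsrc G h"
          unfolding near_M[OF A] by (auto elim!: nearE)
        then have "gsrc G g = grng G h"
          by simp
        then have "(g, h) \<in> composable G" "gmult G g h \<in> arrow_prod G M M"
          using M_arr gh(1,6) unfolding composable_def arrow_prod_def by blast+
        then have "(g, h) \<in> composable G" "gmult G g h \<in> K"
          by (simp_all add: K_def)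
        then show "(x, z) \<in> near G U A"
          using reduce[OF A, of "gmult G g h"] gh by (simp add: rng_mult src_mult)
      qed
    qed
  qed
qed

section \<open>Borel saturations and the assembly of the section\<close>

text \<open>Countably many compact sets exhaust the arrows. Cut down to sources in \<open>A\<close>
  they stay compact, and the union of their images under the range map is the saturation.\<close>

lemma saturation_borel:
  assumes A: "closedin (unit_top G) A"
  shows "{x \<in> units G. orbit G x \<inter> A \<noteq> {}} \<in> borel_sets_of (unit_top G)"
proof -
  interpret sigma_algebra "topspace (unit_top G)" "borel_sets_of (unit_top G)"
    by (rule sigma_algebra_borel_sets_of)
  obtain B :: "nat \<Rightarrow> 'a set" where B: "\<And>n. compactin (arr_top G) (B n)"
    "\<And>U g. openin (arr_top G) U \<Longrightarrow> g \<in> U \<Longrightarrow>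
      \<exists>n V. openin (arr_top G) V \<and> g \<in> V \<and> V \<subseteq> B n \<and> B n \<subseteq> U"
    using countable_compact_neighbourhood_base[OF second_countable_arrows locally_compact_arrows Hausdorff_arrows]
    by blast
  have B_arr: "B n \<subseteq> arrows G" for n
    using compactin_subset_topspace[OF B(1)] by (simp add: arrows_def)
  have B_cover: "\<exists>n. g \<in> B n" if "g \<in> arrows G" for g
    using B(2)[of "topspace (arr_top G)" g] that by (auto simp: arrows_def)
  let ?S = "{g \<in> topspace (arr_top G). gsrc G g \<in> A}"
  have "compactin (arr_top G) (B n \<inter> ?S)" for n
    by (intro compact_Int_closedin B(1) closedin_continuous_map_preimage[OF continuous_src A])
  then have "closedin (unit_top G) (grng G ` (B n \<inter> ?S))" for n
    by (intro compactin_imp_closedin[OF Hausdorff_units] image_compactin[OF _ continuous_rng])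
  then have "(\<Union>n. grng G ` (B n \<inter> ?S)) \<in> borel_sets_of (unit_top G)"
    by (intro countable_UN) (auto intro: closedin_borel_sets_of)
  also have "(\<Union>n. grng G ` (B n \<inter> ?S)) = {x \<in> units G. orbit G x \<inter> A \<noteq> {}}"
  proof (intro set_eqI iffI)
    fix x assume "x \<in> (\<Union>n. grng G ` (B n \<inter> ?S))"
    then obtain g where g: "g \<in> arrows G" "gsrc G g \<in> A" "x = grng G g"
      by (auto simp: arrows_def)
    then have "x \<in> units G" "gsrc G g \<in> orbit G x"
      using rng_closed by (auto simp: orbit_eq)
    with g show "x \<in> {x \<in> units G. orbit G x \<inter> A \<noteq> {}}"
      by blast
  next
    fix x assume "x \<in> {x \<in> units G. orbit G x \<inter> A \<noteq> {}}"
    then obtain y where "x \<in> units G" "y \<in> orbit G x" "y \<in> A"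
      by blast
    then obtain g where g: "g \<in> arrows G" "grng G g = x" "gsrc G g \<in> A"
      by (auto simp: orbit_eq)
    with B_cover[OF g(1)] show "x \<in> (\<Union>n. grng G ` (B n \<inter> ?S))"
      by (auto simp: arrows_def)
  qed
  finally show ?thesis .
qed

text \<open>A single \<open>U\<close> is fixed for the whole unit space before any piece is chosen,
  so the countably many covers can be merged into one sequence for the same nearness.\<close>

lemma ex_countable_near_equiv:
  obtains U and A :: "nat \<Rightarrow> 'b set" where "openin (arr_top G) U" "gid G ` units G \<subseteq> U" "(\<Union>n. A n) = units G"
    and "\<And>n. compactin (unit_top G) (A n)" "\<And>n. equiv (A n) (near G U (A n))"
    and "\<And>n. compactin (prod_topology (unit_top G) (unit_top G)) (near G U (A n))"
proof -
  obtain B :: "nat \<Rightarrow> 'b set" where B: "\<And>n. compactin (unit_top G) (B n)"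
    "\<And>U x. openin (unit_top G) U \<Longrightarrow> x \<in> U \<Longrightarrow>
      \<exists>n V. openin (unit_top G) V \<and> x \<in> V \<and> V \<subseteq> B n \<and> B n \<subseteq> U"
    using countable_compact_neighbourhood_base[OF second_countable_units locally_compact_units Hausdorff_units]
    by blast
  have B_units: "(\<Union>n. B n) = units G"
    using B(2)[OF openin_topspace] compactin_subset_topspace[OF B(1)] by (fastforce simp: units_def)
  obtain U M where U: "openin (arr_top G) U" "gid G ` units G \<subseteq> U" and
    M: "\<And>n. compactin (arr_top G) (M n)" "\<And>n. gid G ` B n \<subseteq> M n"
    "\<And>n g. g \<in> U \<Longrightarrow> grng G g \<in> B n \<Longrightarrow> g \<in> M n"
    using ex_open_unit_neighbourhood[OF B(1) B_units] by blast
  define good where "good A \<longleftrightarrow> compactin (unit_top G) A \<and> equiv A (near G U A) \<and>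
    compactin (prod_topology (unit_top G) (unit_top G)) (near G U A)" for A
  have "\<exists>\<A>. countable \<A> \<and> B n \<subseteq> \<Union>\<A> \<and> (\<forall>A\<in>\<A>. good A)" for n
    using ex_cover_near_equiv[OF U B(1) M(1,2,3)] unfolding good_def by metis
  then obtain \<A> where \<A>: "\<And>n. countable (\<A> n)" "\<And>n. B n \<subseteq> \<Union>(\<A> n)" "\<And>n A. A \<in> \<A> n \<Longrightarrow> good A"
    by metis
  \<comment> \<open>The empty set is good, so it can be added to obtain a nonempty family to
    enumerate.\<close>
  have "near G U {} = {}"
    by (simp add: near_def)
  then have "good {}"
    by (simp add: good_def equiv_def refl_on_def)
  define \<B> where "\<B> = insert {} (\<Union>n. \<A> n)"
  have "countable \<B>" "\<B> \<noteq> {}"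
    using \<A>(1) by (auto simp: \<B>_def)
  then have range: "range (from_nat_into \<B>) = \<B>"
    by (simp add: range_from_nat_into)
  have good_all: "good A" if "A \<in> \<B>" for A
    using that \<open>good {}\<close> \<A>(3) by (auto simp: \<B>_def)
  then have good: "good (from_nat_into \<B> n)" for n
    using from_nat_into[OF \<open>\<B> \<noteq> {}\<close>] by blast
  show thesis
  proof
    have "\<Union>\<B> \<subseteq> units G"
      using good_all compactin_subset_topspace by (fastforce simp: good_def units_def)
    moreover have "units G \<subseteq> \<Union>\<B>"
      using \<A>(2) unfolding B_units[symmetric] \<B>_def by blast
    ultimately show "(\<Union>n. from_nat_into \<B> n) = units G"
      unfolding range by blast
  qed (use U good in \<open>auto simp: good_def\<close>)
qed

theorem lacunary_section:
  "\<exists>Y. Y \<in> borel_sets_of (unit_top G) \<and> (\<forall>x \<in> units G. orbit G x \<inter> Y \<noteq> {})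
     \<and> (\<exists>U. openin (arr_top G) U \<and> gid G ` units G \<subseteq> U \<and> (\<forall>y \<in> Y. translate G {y} U \<inter> Y = {y}))"
proof -
  interpret sigma_algebra "topspace (unit_top G)" "borel_sets_of (unit_top G)"
    by (rule sigma_algebra_borel_sets_of)
  obtain U and A :: "nat \<Rightarrow> 'b set" where U: "openin (arr_top G) U" "gid G ` units G \<subseteq> U"
    and A_units: "(\<Union>n. A n) = units G" and A: "\<And>n. compactin (unit_top G) (A n)"
    "\<And>n. equiv (A n) (near G U (A n))"
    "\<And>n. compactin (prod_topology (unit_top G) (unit_top G)) (near G U (A n))"
    using ex_countable_near_equiv by blast
  have U_arr: "U \<subseteq> arrows G"
    using openin_subset[OF U(1)] by (simp add: arrows_def)
  obtain B :: "nat \<Rightarrow> 'b set" where B: "\<And>n. compactin (unit_top G) (B n)"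
    "\<And>U x. openin (unit_top G) U \<Longrightarrow> x \<in> U \<Longrightarrow>
      \<exists>n V. openin (unit_top G) V \<and> x \<in> V \<and> V \<subseteq> B n \<and> B n \<subseteq> U"
    using countable_compact_neighbourhood_base[OF second_countable_units locally_compact_units Hausdorff_units]
    by blast
  have separating: "\<exists>n. x \<in> B n \<and> y \<notin> B n"
    if "x \<in> topspace (unit_top G)" "y \<in> topspace (unit_top G)" "x \<noteq> y" for x y
  proof -
    have "openin (unit_top G) (topspace (unit_top G) - {y})"
      using that by (intro openin_diff closedin_Hausdorff_singleton[OF Hausdorff_units]) auto
    then show ?thesis
      using B(2)[of "topspace (unit_top G) - {y}" x] that by blast
  qed
  have "\<exists>T. T \<subseteq> A n \<and> T \<in> borel_sets_of (unit_top G) \<and> (\<forall>a\<in>A n. \<exists>t\<in>T. (a, t) \<in> near G U (A n)) \<and>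
     (\<forall>s\<in>T. \<forall>t\<in>T. (s, t) \<in> near G U (A n) \<longrightarrow> s = t)" for n
    by (rule Borel_transversal[OF Hausdorff_units B(1) separating A(1-3)[of n]]) blast+
  then obtain T where T: "\<And>n. T n \<subseteq> A n" "\<And>n. T n \<in> borel_sets_of (unit_top G)"
    "\<And>n a. a \<in> A n \<Longrightarrow> \<exists>t\<in>T n. (a, t) \<in> near G U (A n)"
    "\<And>n s t. s \<in> T n \<Longrightarrow> t \<in> T n \<Longrightarrow> (s, t) \<in> near G U (A n) \<Longrightarrow> s = t"
    by metis
  define sat where "sat n = {x \<in> units G. orbit G x \<inter> A n \<noteq> {}}" for n
  have sat_borel: "sat n \<in> borel_sets_of (unit_top G)" for n
    unfolding sat_def by (intro saturation_borel compactin_imp_closedin[OF Hausdorff_units A(1)])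
  have sat_orbit: "y \<in> sat n" if xy: "x \<in> sat n" "y \<in> orbit G x" for x y n
  proof -
    have x: "x \<in> units G" and y: "y \<in> units G"
      using xy orbit_subset_units by (auto simp: sat_def)
    obtain a where "a \<in> orbit G x" "a \<in> A n"
      using xy(1) by (auto simp: sat_def)
    then show ?thesis
      using orbit_trans[OF y orbit_sym[OF x xy(2)]] y by (auto simp: sat_def)
  qed
  \<comment> \<open>Removing earlier saturations leaves an orbit represented only at the first index
    \<open>n\<close> for which it meets \<open>A n\<close>.\<close>
  define Y where "Y = (\<Union>n. T n - (\<Union>m<n. sat m))"
  have A_sat: "A n \<subseteq> sat n" for n
    using A_units self_in_orbit by (auto simp: sat_def)
  have Y_units: "Y \<subseteq> units G"
    using T(1) A_units by (auto simp: Y_def)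
  have Y_borel: "Y \<in> borel_sets_of (unit_top G)"
    unfolding Y_def by (intro countable_UN image_subsetI Diff finite_UN T(2) sat_borel) auto
  have Y_complete: "orbit G x \<inter> Y \<noteq> {}" if x: "x \<in> units G" for x
  proof -
    have "\<exists>n. x \<in> sat n"
      using x A_units A_sat by blast
    \<comment> \<open>At the first index, move from a point \<open>a\<close> of the orbit in
      \<open>A n\<close> to a near point \<open>t\<close> of the transversal. Near points share an
      orbit, so \<open>t\<close> also avoids the earlier saturations.\<close>
    then obtain n where n: "x \<in> sat n" "\<And>m. m < n \<Longrightarrow> x \<notin> sat m"
      using exists_least_iff[of "\<lambda>n. x \<in> sat n"] by auto
    then obtain a where a: "a \<in> orbit G x" "a \<in> A n"
      by (auto simp: sat_def)
    then obtain t where t: "t \<in> T n" "(a, t) \<in> near G U (A n)"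
      using T(3) by blast
    have "a \<in> units G"
      using a A_units by blast
    then have "t \<in> orbit G a"
      using t(2) U_arr by (auto simp: near_def orbit_eq)
    then have tx: "t \<in> orbit G x"
      using orbit_trans x a by blast
    then have "t \<notin> sat m" if "m < n" for m
      using n(2)[OF that] sat_orbit orbit_sym[OF x tx] by blast
    then have "t \<in> Y"
      using t(1) by (auto simp: Y_def)
    with tx show ?thesis
      by blast
  qed
  have Y_lacunary: "translate G {y} U \<inter> Y = {y}" if y: "y \<in> Y" for y
  proof -
    have yu: "y \<in> units G"
      using y Y_units by blast
    have translate: "translate G {y} U = {gsrc G g | g. g \<in> U \<and> grng G g = y}"
      using yu U_arr by (rule translate_singleton)
    have "gid G y \<in> U"
      using U(2) yu by auto
    then have "y \<in> translate G {y} U"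
      unfolding translate using rng_id[OF yu] src_id[OF yu] by force
    moreover have "z = y" if z: "z \<in> translate G {y} U" "z \<in> Y" for z
    proof -
      obtain g where g: "g \<in> U" "grng G g = y" "gsrc G g = z"
        using z(1) unfolding translate by auto
      then have zy: "z \<in> orbit G y"
        using yu U_arr by (auto simp: orbit_eq)
      have yz: "y \<in> orbit G z"
        using orbit_sym[OF yu zy] .
      obtain n where n: "y \<in> T n" "\<And>m. m < n \<Longrightarrow> y \<notin> sat m"
        using y by (auto simp: Y_def)
      obtain k where k: "z \<in> T k" "\<And>m. m < k \<Longrightarrow> z \<notin> sat m"
        using z(2) by (auto simp: Y_def)
      \<comment> \<open>\<open>y\<close> and \<open>z\<close> share an orbit, hence lie in the same
        saturations. If \<open>n\<close> and \<open>k\<close> differed, the point with the larger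
        index would have been removed from \<open>Y\<close>. Then \<open>g\<close> itself makes
        \<open>y\<close> and \<open>z\<close> near within \<open>A n\<close>.\<close>
      have "y \<in> sat n" "z \<in> sat k"
        using n(1) k(1) T(1) A_sat by blast+
      then have "z \<in> sat n" "y \<in> sat k"
        using sat_orbit zy yz by blast+
      then have "n = k"
        using n(2) k(2) by (metis linorder_neqE_nat)
      then have "(y, z) \<in> near G U (A n)"
        using nearI[of g U G "A n"] g n(1) k(1) T(1) by auto
      then show "z = y"
        using T(4) n(1) k(1) \<open>n = k\<close> by metis
    qed
    ultimately show ?thesis
      using y by blast
  qed
  show ?thesis
    using Y_borel Y_complete Y_lacunary U by blast
qed

end

theorem theoremA:
  fixes G :: "('g, 'x) top_groupoid"
  assumes "continuous_groupoid G"
    and "second_countable (unit_top G)"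
    and "locally_compact_space (unit_top G)"
    and "Hausdorff_space (unit_top G)"
    and "second_countable (arr_top G)"
    and "locally_compact_space (arr_top G)"
    and "locally_Hausdorff_space (arr_top G)"
    and "closedin (arr_top G) (gid G ` units G)"
    and "homeomorphic_map (unit_top G) (subtopology (arr_top G) (gid G ` units G)) (gid G)"
  shows "\<exists>Y. Y \<in> borel_sets_of (unit_top G)
           \<and> (\<forall>x \<in> units G. orbit G x \<inter> Y \<noteq> {})
           \<and> (\<exists>U. openin (arr_top G) U \<and> gid G ` units G \<subseteq> U
                \<and> (\<forall>y \<in> Y. translate G {y} U \<inter> Y = {y}))"
proof -
  have "continuous_map (unit_top G) (arr_top G) (gid G)"
    using homeomorphic_imp_continuous_map[OF assms(9)] by (rule continuous_map_into_fulltopology)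
  then interpret lc_groupoid G
    using assms by (intro lc_groupoid.intro lc_groupoid_axioms.intro) auto
  show ?thesis
    by (rule lacunary_section)
qed

end
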